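(* Let $q$ be a prime power and $n,m,k$ integers with $1<k<n$, $m<n\le km$, and either $m\ge4$, or $m=3$ and $n\ge5$. Let $\mathcal C$ be a nondegenerate $L_{\mathrm{rk}}$-optimal $[n,k,d]_{q^m/q}$ code. Then the dual code $\mathcal C^\perp$ is either degenerate or not $L_{\mathrm{rk}}$-optimal.
   Context: $\mathbb{F}_{q^m}$ is the degree-$m$ extension of $\mathbb{F}_q$. Rank weight of $\mathbf v=(v_1,\dots,v_n)\in\mathbb{F}_{q^m}^n$: $\mathrm{w}(\mathbf v)=\dim_{\mathbb{F}_q}\langle v_1,\dots,v_n\rangle_{\mathbb{F}_q}$. An $[n,k,d]_{q^m/q}$ code is a $k$-dimensional $\mathbb{F}_{q^m}$-subspace $\mathcal C\subseteq\mathbb{F}_{q^m}^n$ with minimum nonzero rank weight $d$; nondegenerate means the $\mathbb{F}_q$-span of the columns of a generator matrix has $\mathbb{F}_q$-dimension $n$. The dual code is $\mathcal C^\perp=\{\mathbf d\in\mathbb{F}_{q^m}^n:\sum_i c_id_i=0\ \forall\,\mathbf c\in\mathcal C\}$, an $[n,n-k]_{q^m/q}$ code. $\mathrm{WS}(\mathcal C)=\{\mathrm{w}(\mathbf c):\mathbf c\in\mathcal C\setminus\{\mathbf 0\}\}$; $L_{\mathrm{rk}}(n,m,k',q)$ is the maximum of $|\mathrm{WS}|$ over nondegenerate $[n,k']_{q^m/q}$ codes, and a nondegenerate $[n,k']_{q^m/q}$ code is $L_{\mathrm{rk}}$-optimal if its weight spectrum has size $L_{\mathrm{rk}}(n,m,k',q)$.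 *)

theory Defs
  imports
    "HOL-Analysis.Cartesian_Space"
    "HOL-Library.Function_Algebras"
    "HOL-Number_Theory.Prime_Powers"
begin

text \<open>
  An extension of finite fields is given by two types and an embedding \<open>\<phi>\<close> of the
  small field \<open>'f\<close> into the large field \<open>'a\<close>. This makes \<open>'a\<close>, and functions into it,
  vector spaces over \<open>'f\<close>. The library's \<open>dim S\<close> is the dimension of the span of \<open>S\<close>.
\<close>

definition field_embedding :: "('f::field \<Rightarrow> 'a::field) \<Rightarrow> bool" where
  "field_embedding \<phi> \<longleftrightarrow>
     \<phi> 1 = 1 \<and> (\<forall>x y. \<phi> (x + y) = \<phi> x + \<phi> y) \<and> (\<forall>x y. \<phi> (x * y) = \<phi> x * \<phi> y)"

definition ext_scale :: "('f::field \<Rightarrow> 'a::field) \<Rightarrow> 'f \<Rightarrow> 'a \<Rightarrow> 'a" where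
  "ext_scale \<phi> c x = \<phi> c * x"

definition ext_scale_fun :: "('f::field \<Rightarrow> 'a::field) \<Rightarrow> 'f \<Rightarrow> ('i \<Rightarrow> 'a) \<Rightarrow> ('i \<Rightarrow> 'a)" where
  "ext_scale_fun \<phi> c f = (\<lambda>i. \<phi> c * f i)"

definition ext_degree :: "('f::field \<Rightarrow> 'a::field) \<Rightarrow> nat" where
  "ext_degree \<phi> = vector_space.dim (ext_scale \<phi>) (UNIV :: 'a set)"

definition rank_weight :: "('f::field \<Rightarrow> 'a::field) \<Rightarrow> 'a ^ 'n \<Rightarrow> nat" where
  "rank_weight \<phi> v = vector_space.dim (ext_scale \<phi>) (range (\<lambda>j. vec_nth v j))"

definition weight_spectrum :: "('f::field \<Rightarrow> 'a::field) \<Rightarrow> ('a ^ 'n) set \<Rightarrow> nat set" where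
  "weight_spectrum \<phi> C = rank_weight \<phi> ` (C - {0})"

definition is_code :: "nat \<Rightarrow> ('a::field ^ 'n) set \<Rightarrow> bool" where
  "is_code k C \<longleftrightarrow> vec.subspace C \<and> vec.dim C = k"

definition min_distance :: "('f::field \<Rightarrow> 'a::field) \<Rightarrow> ('a ^ 'n) set \<Rightarrow> nat" where
  "min_distance \<phi> C = Min (weight_spectrum \<phi> C)"

text \<open>
  A matrix with \<open>k\<close> rows of length \<open>CARD('n)\<close> is a function \<open>G\<close> whose values \<open>G 0, \<dots>, G (k - 1)\<close>
  are the rows; other values are ignored. Its columns, vectors of length \<open>k\<close>, are functions
  on the naturals that vanish from \<open>k\<close> on.
\<close>

definition generator_matrix :: "nat \<Rightarrow> (nat \<Rightarrow> 'a::field ^ 'n) \<Rightarrow> ('a ^ 'n) set \<Rightarrow> bool" where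
  "generator_matrix k G C \<longleftrightarrow>
     inj_on G {..<k} \<and> vec.independent (G ` {..<k}) \<and> vec.span (G ` {..<k}) = C"

definition matrix_column :: "nat \<Rightarrow> (nat \<Rightarrow> 'a::field ^ 'n) \<Rightarrow> 'n \<Rightarrow> (nat \<Rightarrow> 'a)" where
  "matrix_column k G j = (\<lambda>i. if i < k then vec_nth (G i) j else 0)"

definition nondegenerate :: "('f::field \<Rightarrow> 'a::field) \<Rightarrow> ('a ^ 'n) set \<Rightarrow> bool" where
  "nondegenerate \<phi> C \<longleftrightarrow>
     (\<exists>G. generator_matrix (vec.dim C) G C \<and>
          vector_space.dim (ext_scale_fun \<phi>) (range (matrix_column (vec.dim C) G)) = CARD('n))"

definition dual_code :: "('a::field ^ 'n) set \<Rightarrow> ('a ^ 'n) set" where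
  "dual_code C = {x. \<forall>c\<in>C. (\<Sum>i\<in>UNIV. vec_nth c i * vec_nth x i) = 0}"

text \<open>
  The parameters \<open>q\<close> and \<open>m\<close> of \<open>L\<^sub>r\<^sub>k(n, m, k, q)\<close> enter through \<open>\<phi>\<close>, and \<open>n\<close> through the
  index type \<open>'n\<close>. If there is no nondegenerate code of dimension \<open>k\<close>, the value is
  unspecified; it is then never used in \<open>L_rk_optimal\<close>.
\<close>

definition L_rk :: "('f::field \<Rightarrow> 'a::field) \<Rightarrow> 'n::finite itself \<Rightarrow> nat \<Rightarrow> nat" where
  "L_rk \<phi> _ k =
     Max {card (weight_spectrum \<phi> C) | C :: ('a ^ 'n) set. is_code k C \<and> nondegenerate \<phi> C}"

definition L_rk_optimal :: "('f::field \<Rightarrow> 'a::field) \<Rightarrow> ('a ^ 'n) set \<Rightarrow> bool" where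
  "L_rk_optimal \<phi> C \<longleftrightarrow>
     vec.subspace C \<and> nondegenerate \<phi> C \<and>
     card (weight_spectrum \<phi> C) = L_rk \<phi> TYPE('n) (vec.dim C)"

end

theory Submission imports Defs begin

text \<open>
  A word of rank weight 1 is a scalar multiple of a vector over the small field, so if it lies in
  \<open>C\<close> it gives a linear relation over the small field between the columns of every generator matrix
  of \<open>dual_code C\<close>, and vice versa. Hence if both codes are nondegenerate, their
  weights lie in \<open>{2..m}\<close>. On the other hand, for \<open>K \<ge> n / 2\<close> (which holds for one of the two
  dimensions) there is a nondegenerate code of dimension \<open>K\<close> all of whose weights \<open>1, \<dots>, m\<close> occur:
  cut the word \<open>(b\<^sub>0, b\<^sub>1, \<dots>, b\<^bsub>n-1\<^esub>)\<close>, where the \<open>b\<^sub>j\<close> run periodically through a basis of the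
  large field, into \<open>K\<close> blocks of consecutive entries of suitable lengths at most 3, and let the
  blocks generate the code. The sum of the blocks that make up an interval of length \<open>w \<le> m\<close> has
  weight \<open>w\<close>.
\<close>

section \<open>Families of vectors and the dimension of their span\<close>

lemma sum_fun_apply: "(\<Sum>i\<in>A. f i) x = (\<Sum>i\<in>A. f i x)"
  by (induction A rule: infinite_finite_induct) auto

text \<open>The image has at most \<open>card I\<close> elements, so this dimension forces
  \<open>f\<close> to be injective on \<open>I\<close> and its values to be independent. The column
  condition in \<open>nondegenerate\<close> thus becomes one on linear relations; over the large
  field the same criterion serves for rows.\<close>

lemma (in vector_space) dim_image_eq_card_iff:
  assumes "finite I"
  shows "dim (f ` I) = card I \<longleftrightarrow>
    (\<forall>u. (\<Sum>i\<in>I. scale (u i) (f i)) = 0 \<longrightarrow> (\<forall>i\<in>I. u i = 0))"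
proof
  assume dim: "dim (f ` I) = card I"
  obtain B where B: "B \<subseteq> f ` I" "independent B" "f ` I \<subseteq> span B" "card B = dim (f ` I)"
    using basis_exists by blast
  have "card (f ` I) = card I"
    using B dim assms card_image_le[OF assms, of f] card_mono[of "f ` I" B] by simp
  then have inj: "inj_on f I"
    using assms by (rule eq_card_imp_inj_on[rotated])
  have "B = f ` I"
    using B dim assms \<open>card (f ` I) = card I\<close> by (simp add: card_subset_eq)
  then have indep: "independent (f ` I)"
    using B by simp
  show "\<forall>u. (\<Sum>i\<in>I. scale (u i) (f i)) = 0 \<longrightarrow> (\<forall>i\<in>I. u i = 0)"
  proof (intro allI impI ballI)
    fix u i assume sum0: "(\<Sum>i\<in>I. scale (u i) (f i)) = 0" and "i \<in> I"
    define g where "g = the_inv_into I f"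
    have g: "g (f j) = j" if "j \<in> I" for j
      using that inj by (simp add: g_def the_inv_into_f_f)
    have "(\<Sum>v\<in>f ` I. scale (u (g v)) v) = (\<Sum>i\<in>I. scale (u i) (f i))"
      by (subst sum.reindex[OF inj]) (auto intro!: sum.cong simp: g)
    then have "u (g (f i)) = 0"
      using sum0 indep assms \<open>i \<in> I\<close> independentD[of "f ` I" "f ` I" "\<lambda>v. u (g v)" "f i"] by auto
    then show "u i = 0"
      using g \<open>i \<in> I\<close> by simp
  qed
next
  assume indep: "\<forall>u. (\<Sum>i\<in>I. scale (u i) (f i)) = 0 \<longrightarrow> (\<forall>i\<in>I. u i = 0)"
  have inj: "inj_on f I"
  proof (rule inj_onI, rule ccontr)
    fix i j assume ij: "i \<in> I" "j \<in> I" "f i = f j" "i \<noteq> j"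
    define u where "u l = (if l = i then 1 else if l = j then - 1 else (0 :: 'a))" for l
    have "(\<Sum>l\<in>I. scale (u l) (f l)) = (\<Sum>l\<in>{i, j}. scale (u l) (f l))"
      using ij assms by (intro sum.mono_neutral_right) (auto simp: u_def)
    also have "\<dots> = 0"
      using ij by (simp add: u_def)
    finally show False
      using indep ij(1) by (metis u_def zero_neq_one)
  qed
  have "independent (f ` I)"
    using assms indep by (auto simp: dependent_finite sum.reindex[OF inj])
  then show "dim (f ` I) = card I"
    by (simp add: dim_eq_card_independent card_image[OF inj])
qed

section \<open>Rank weights over an extension of finite fields\<close>

locale field_extension =
  fixes \<phi> :: "'f::{field,finite} \<Rightarrow> 'a::{field,finite}"
  assumes embedding: "field_embedding \<phi>"
begin

lemma hom: "\<phi> 1 = 1" "\<phi> (x + y) = \<phi> x + \<phi> y" "\<phi> (x * y) = \<phi> x * \<phi> y"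
  using embedding by (auto simp: field_embedding_def)

sublocale ext: vector_space "ext_scale \<phi>"
  by unfold_locales (simp_all add: ext_scale_def hom algebra_simps)

sublocale ext_fun: vector_space "ext_scale_fun \<phi> :: 'f \<Rightarrow> (nat \<Rightarrow> 'a) \<Rightarrow> _"
  by unfold_locales (auto simp: ext_scale_fun_def hom algebra_simps)

lemma hom_0 [simp]: "\<phi> 0 = 0"
  using hom(2)[of 0 0] by (metis add_0_right add_left_cancel)

lemma hom_eq_0_iff [simp]: "\<phi> x = 0 \<longleftrightarrow> x = 0"
  using hom(1) hom(3)[of x "inverse x"] by (cases "x = 0") auto

lemma rank_weight_le_ext_degree: "rank_weight \<phi> v \<le> ext_degree \<phi>"
proof -
  obtain B where B: "ext.independent B" "UNIV \<subseteq> ext.span B" "card B = ext.dim UNIV"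
    using ext.basis_exists[of UNIV] by blast
  then have "ext.dim (range (\<lambda>j. vec_nth v j)) \<le> card B"
    by (intro ext.dim_le_card) auto
  then show ?thesis
    using B by (simp add: rank_weight_def ext_degree_def)
qed

lemma rank_weight_le_1D:
  fixes v :: "'a ^ 'n"
  assumes "rank_weight \<phi> v \<le> 1"
  obtains l u where "\<And>j. v $ j = \<phi> (u j) * l"
proof -
  obtain B where B: "range (\<lambda>j. v $ j) \<subseteq> ext.span B" "card B = rank_weight \<phi> v"
    unfolding rank_weight_def using ext.basis_exists[of "range (\<lambda>j. v $ j)"] by metis
  \<comment> \<open>An empty \<open>B\<close> lies in \<open>{l}\<close> for any \<open>l\<close>,
    so the zero word is covered too.\<close>
  moreover obtain l where "B \<subseteq> {l}"
    using assms B(2) card_le_Suc0_iff_eq[of B] by (cases "B = {}") auto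
  ultimately have "\<forall>j. \<exists>c. v $ j = \<phi> c * l"
    using ext.span_mono[OF \<open>B \<subseteq> {l}\<close>] by (force simp: ext.span_singleton ext_scale_def)
  then show ?thesis
    using that by metis
qed

section \<open>Nondegeneracy and words of rank weight 1\<close>

text \<open>Row by row, the combination of the columns with coefficients \<open>u j\<close> is the
  product of \<open>u\<close> with a row of \<open>G\<close>, which lies in \<open>C\<close>. So it
  vanishes, while the columns are independent over the small field.\<close>

lemma orthogonal_to_nondegenerate:
  fixes C :: "('a ^ 'n) set"
  assumes "nondegenerate \<phi> C" and "\<And>c. c \<in> C \<Longrightarrow> (\<Sum>j\<in>UNIV. \<phi> (u j) * c $ j) = 0"
  shows "u j = 0"
proof -
  obtain G where G: "generator_matrix (vec.dim C) G C"
    and dim: "ext_fun.dim (matrix_column (vec.dim C) G ` UNIV) = CARD('n)"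
    using assms(1) by (auto simp: nondegenerate_def)
  have "G i \<in> C" if "i < vec.dim C" for i
    using G that by (auto simp: generator_matrix_def intro: vec.span_base)
  \<comment> \<open>Entries from row \<open>vec.dim C\<close> on are zero in
    \<open>matrix_column\<close>, so the relation holds at every natural \<open>i\<close>.\<close>
  then have "(\<Sum>j\<in>UNIV. \<phi> (u j) * (if i < vec.dim C then G i $ j else 0)) = 0" for i
    using assms(2) by (cases "i < vec.dim C") auto
  then have "(\<Sum>j\<in>UNIV. ext_scale_fun \<phi> (u j) (matrix_column (vec.dim C) G j)) = 0"
    by (simp add: fun_eq_iff ext_scale_fun_def matrix_column_def sum_fun_apply)
  then show ?thesis
    using dim by (simp add: ext_fun.dim_image_eq_card_iff)
qed

text \<open>In a word of weight at most 1 all entries are small-field multiples of one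
  \<open>l\<close>; cancelling \<open>l\<close> leaves a small-field word orthogonal to
  \<open>C\<close>. The form with a single word \<open>v\<close> fits both a code tested against its
  dual and the dual tested against the code.\<close>

lemma rank_weight_ge_2:
  fixes C :: "('a ^ 'n) set"
  assumes "nondegenerate \<phi> C" and "\<And>c. c \<in> C \<Longrightarrow> (\<Sum>j\<in>UNIV. v $ j * c $ j) = 0" and "v \<noteq> 0"
  shows "2 \<le> rank_weight \<phi> v"
proof (rule ccontr)
  assume "\<not> 2 \<le> rank_weight \<phi> v"
  then obtain l u where lu: "\<And>j. v $ j = \<phi> (u j) * l"
    using rank_weight_le_1D[of v] by (metis not_less_eq_eq numeral_2_eq_2 One_nat_def)
  then have "l \<noteq> 0"
    using \<open>v \<noteq> 0\<close> by (auto simp: vec_eq_iff)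
  have "l * (\<Sum>j\<in>UNIV. \<phi> (u j) * c $ j) = 0" if "c \<in> C" for c
    using assms(2)[OF that] by (simp add: lu sum_distrib_left mult_ac)
  then have "u j = 0" for j
    using \<open>l \<noteq> 0\<close> by (intro orthogonal_to_nondegenerate[OF assms(1)]) auto
  then show False
    using \<open>v \<noteq> 0\<close> by (simp add: vec_eq_iff lu)
qed

lemma card_weight_spectrum_less:
  assumes "\<And>v. v \<in> C \<Longrightarrow> v \<noteq> 0 \<Longrightarrow> 2 \<le> rank_weight \<phi> v" and "1 \<le> ext_degree \<phi>"
  shows "card (weight_spectrum \<phi> C) < ext_degree \<phi>"
proof -
  have "weight_spectrum \<phi> C \<subseteq> {2..ext_degree \<phi>}"
    by (auto simp: weight_spectrum_def intro: assms(1) rank_weight_le_ext_degree)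
  then have "card (weight_spectrum \<phi> C) \<le> card {2..ext_degree \<phi>}"
    by (intro card_mono) auto
  then show ?thesis
    using assms(2) by simp
qed

section \<open>Codes attaining every weight up to the extension degree\<close>

lemma L_rk_ge:
  fixes C :: "('a ^ 'n) set"
  assumes "is_code K C" and "nondegenerate \<phi> C" and "{1..m} \<subseteq> weight_spectrum \<phi> C"
  shows "m \<le> L_rk \<phi> TYPE('n) K"
proof -
  have "m \<le> card (weight_spectrum \<phi> C)"
    using card_mono[OF _ assms(3)] by (simp add: weight_spectrum_def)
  also have "\<dots> \<le> L_rk \<phi> TYPE('n) K"
    unfolding L_rk_def using assms by (intro Max_ge) auto
  finally show ?thesis .
qed

text \<open>Here \<open>\<beta> j\<close> is the number of the block that contains position
  \<open>j\<close>. Since no block is empty, the \<open>K\<close> generators are independent.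
  Positions in one block are less than 3 apart, which gives nondegeneracy. By
  \<open>intervals\<close>, each length \<open>w\<close> is that of an interval made of whole
  blocks, which yields a word of weight \<open>w\<close>.\<close>

lemma full_weight_spectrum_code:
  fixes \<beta> :: "nat \<Rightarrow> nat"
  assumes m: "3 \<le> ext_degree \<phi>"
    and range: "\<beta> ` {..<CARD('n)} = {..<K}"
    and blocks: "\<And>i j. i < CARD('n) \<Longrightarrow> j < CARD('n) \<Longrightarrow> \<beta> i = \<beta> j \<Longrightarrow> j < i + 3"
    and intervals: "\<And>w. 1 \<le> w \<Longrightarrow> w \<le> ext_degree \<phi> \<Longrightarrow> \<exists>i I. i + w \<le> CARD('n) \<and> I \<subseteq> {..<K} \<and>
           (\<forall>j<CARD('n). \<beta> j \<in> I \<longleftrightarrow> i \<le> j \<and> j < i + w)"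
  obtains C :: "('a ^ 'n) set"
  where "is_code K C" "nondegenerate \<phi> C" "{1..ext_degree \<phi>} \<subseteq> weight_spectrum \<phi> C"
proof -
  define m where "m = ext_degree \<phi>"
  obtain B where B: "ext.independent B" "UNIV \<subseteq> ext.span B" "card B = m"
    using ext.basis_exists[of UNIV] by (auto simp: ext_degree_def m_def)
  obtain b where b: "bij_betw b {..<m} B"
    using B(3) ex_bij_betw_nat_finite[of B] by (auto simp: lessThan_atLeast0)
  obtain e :: "'n \<Rightarrow> nat" where e: "bij_betw e UNIV {..<CARD('n)}"
    using ex_bij_betw_finite_nat[of "UNIV :: 'n set"] by (auto simp: lessThan_atLeast0)
  have e_less: "e j < CARD('n)" for j
    using e by (auto simp: bij_betw_def)
  have e_inj: "e i = e j \<longleftrightarrow> i = j" for i j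
    using e by (auto simp: bij_betw_def inj_eq)
  have e_surj: "\<exists>j. e j = i" if "i < CARD('n)" for i
    using e that by (auto simp: bij_betw_def) (metis imageE lessThan_iff)
  define v where "v j = b (j mod m)" for j
  have "m \<ge> 3"
    using m by (simp add: m_def)
  have v_B: "v j \<in> B" for j
    using b \<open>m \<ge> 3\<close> by (auto simp: v_def bij_betw_def)
  have v_nz: "v j \<noteq> 0" for j
    using v_B B(1) ext.dependent_zero by metis
  \<comment> \<open>The letters repeat with period \<open>m\<close>, so any \<open>m\<close>
    consecutive ones are distinct.\<close>
  have v_inj: "i = j" if "v i = v j" "i < j + m" "j < i + m" for i j
  proof -
    have "i mod m = j mod m"
      using that(1) b \<open>m \<ge> 3\<close> by (auto simp: v_def bij_betw_def inj_on_def)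
    then obtain s t where "i + m * s = j + m * t"
      using nat_mod_eq_iff by blast
    then show ?thesis
      using that by (cases s t rule: linorder_cases) (auto dest!: less_imp_Suc_add simp: algebra_simps)
  qed

  \<comment> \<open>\<open>R i\<close> keeps the letters of block \<open>i\<close> and is zero
    elsewhere. The supports are disjoint, so each coordinate of a combination involves only one
    generator.\<close>
  define R where "R i = (\<chi> j. if \<beta> (e j) = i then v (e j) else 0)" for i :: nat
  define C where "C = vec.span (R ` {..<K})"
  have R_sum: "(\<Sum>i\<in>I. u i *s R i) $ j = (if \<beta> (e j) \<in> I then u (\<beta> (e j)) * v (e j) else 0)"
    if "finite I" for I u j
  proof -
    have "(\<Sum>i\<in>I. u i *s R i) $ j = (\<Sum>i\<in>I. if i = \<beta> (e j) then u i * v (e j) else 0)"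
      by (auto simp: R_def intro!: sum.cong)
    then show ?thesis
      using that by simp
  qed
  have R_dim: "vec.dim (R ` {..<K}) = card {..<K}"
  proof (subst vec.dim_image_eq_card_iff, safe)
    fix u i assume 0: "(\<Sum>i<K. u i *s R i) = 0" and "i < K"
    then have "i \<in> \<beta> ` {..<CARD('n)}"
      by (simp add: range)
    then obtain j where "\<beta> (e j) = i"
      using e_surj by blast
    then show "u i = 0"
      using R_sum[of "{..<K}" u j] 0 v_nz \<open>i < K\<close> by simp
  qed
  have R_inj: "inj_on R {..<K}"
  proof (rule eq_card_imp_inj_on)
    show "card (R ` {..<K}) = card {..<K}"
      using R_dim vec.dim_le_card'[of "R ` {..<K}"] card_image_le[of "{..<K}" R] by simp
  qed simp
  have R_indep: "vec.independent (R ` {..<K})"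
    using R_dim by (intro vec.card_le_dim_spanning[of _ "R ` {..<K}"])
      (auto simp: card_image[OF R_inj] intro: vec.span_base)
  have C_dim: "vec.dim C = K"
    using R_dim by (simp add: C_def)
  have "is_code K C"
    using C_dim by (simp add: is_code_def C_def)
  moreover have "nondegenerate \<phi> C"
    unfolding nondegenerate_def C_dim
  proof (intro exI conjI)
    show "generator_matrix K R C"
      using R_inj R_indep by (simp add: generator_matrix_def C_def)
    show "ext_fun.dim (range (matrix_column K R)) = CARD('n)"
    proof (subst ext_fun.dim_image_eq_card_iff, safe)
      fix u :: "'n \<Rightarrow> 'f" and j
      assume 0: "(\<Sum>j\<in>UNIV. ext_scale_fun \<phi> (u j) (matrix_column K R j)) = 0"
      \<comment> \<open>Row \<open>\<beta> (e j)\<close> is zero outside the positions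
        \<open>J\<close> of its block, so the relation between columns becomes one between the
        letters of this block. These are distinct basis elements because
        \<open>3 \<le> m\<close>.\<close>
      define J where "J = {l. \<beta> (e l) = \<beta> (e j)}"
      have "\<beta> (e j) < K"
        using range e_less[of j] by auto
      have "0 = (\<Sum>j\<in>UNIV. ext_scale_fun \<phi> (u j) (matrix_column K R j)) (\<beta> (e j))"
        using 0 by simp
      also have "\<dots> = (\<Sum>l\<in>UNIV. if l \<in> J then ext_scale \<phi> (u l) (v (e l)) else 0)"
        using \<open>\<beta> (e j) < K\<close>
        by (auto simp: ext_scale_fun_def ext_scale_def matrix_column_def R_def J_def sum_fun_apply
            intro!: sum.cong)
      also have "\<dots> = (\<Sum>l\<in>J. ext_scale \<phi> (u l) (v (e l)))"
        by (simp add: sum.If_cases)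
      finally have *: "(\<Sum>l\<in>J. ext_scale \<phi> (u l) (v (e l))) = 0"
        by simp
      have "inj_on (\<lambda>l. v (e l)) J"
      proof (rule inj_onI)
        fix i l assume "i \<in> J" "l \<in> J" "v (e i) = v (e l)"
        moreover have "e i < e l + 3" "e l < e i + 3"
          using \<open>i \<in> J\<close> \<open>l \<in> J\<close> e_less by (auto simp: J_def intro: blocks)
        ultimately have "e i = e l"
          using \<open>m \<ge> 3\<close> by (intro v_inj) auto
        then show "i = l"
          by (simp add: e_inj)
      qed
      moreover have "ext.independent ((\<lambda>l. v (e l)) ` J)"
        using B(1) by (rule ext.independent_mono) (auto simp: v_B)
      ultimately have "ext.dim ((\<lambda>l. v (e l)) ` J) = card J"
        by (simp add: ext.dim_eq_card_independent card_image)
      then show "u j = 0"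
        using * by (subst (asm) ext.dim_image_eq_card_iff) (auto simp: J_def)
    qed simp
  qed
  moreover have "{1..ext_degree \<phi>} \<subseteq> weight_spectrum \<phi> C"
  proof
    fix w assume "w \<in> {1..ext_degree \<phi>}"
    then have w: "1 \<le> w" "w \<le> m"
      by (auto simp: m_def)
    then obtain i I where iI: "i + w \<le> CARD('n)" "I \<subseteq> {..<K}"
      "\<And>j. j < CARD('n) \<Longrightarrow> \<beta> j \<in> I \<longleftrightarrow> i \<le> j \<and> j < i + w"
      using intervals[of w] unfolding m_def by blast
    define c where "c = (\<Sum>i\<in>I. R i)"
    have "finite I"
      using iI(2) finite_subset by blast
    then have c: "c $ j = (if i \<le> e j \<and> e j < i + w then v (e j) else 0)" for j
      using R_sum[of I "\<lambda>_. 1" j] iI(3)[OF e_less[of j]] by (simp add: c_def)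
    have "c \<in> C"
      using iI(2) unfolding c_def C_def by (intro vec.span_sum vec.span_base) auto
    moreover have "c \<noteq> 0"
    proof -
      obtain j where "e j = i"
        using e_surj[of i] iI(1) w by auto
      then show ?thesis
        using c[of j] w v_nz[of i] by auto
    qed
    \<comment> \<open>The nonzero entries of \<open>c\<close> are \<open>w\<close> consecutive
      letters, distinct since \<open>w \<le> m\<close>.\<close>
    moreover have "rank_weight \<phi> c = w"
      unfolding rank_weight_def
    proof (rule ext.dim_unique)
      show "v ` {i..<i + w} \<subseteq> range (\<lambda>j. c $ j)"
      proof
        fix x assume "x \<in> v ` {i..<i + w}"
        then obtain l where l: "x = v l" "i \<le> l" "l < i + w"
          by auto
        then obtain j where "e j = l"
          using e_surj[of l] iI(1) by auto
        then show "x \<in> range (\<lambda>j. c $ j)"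
          using l c[of j] by (auto intro: range_eqI[of _ _ j])
      qed
      show "range (\<lambda>j. c $ j) \<subseteq> ext.span (v ` {i..<i + w})"
        by (auto simp: c intro: ext.span_base ext.span_zero)
      show "ext.independent (v ` {i..<i + w})"
        using B(1) by (rule ext.independent_mono) (auto simp: v_B)
      have "inj_on v {i..<i + w}"
        using w by (auto intro!: inj_onI v_inj)
      then show "card (v ` {i..<i + w}) = w"
        by (simp add: card_image)
    qed
    ultimately show "w \<in> weight_spectrum \<phi> C"
      by (auto simp: weight_spectrum_def)
  qed
  ultimately show ?thesis
    by (rule that)
qed

section \<open>Choice of the block lengths\<close>

text \<open>Odd weights need an odd block. If \<open>CARD('n) < 2 * K\<close>, lengths 1 and 2
  suffice. For \<open>CARD('n) = 2 * K\<close> the average length is 2, so a block of length 1 must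
  be balanced by one of length 3; a third block then supplies weight 2.\<close>

lemma L_rk_ge_ext_degree:
  assumes "3 \<le> ext_degree \<phi>" "ext_degree \<phi> < CARD('n::finite)" "K \<le> CARD('n)"
    and "CARD('n) < 2 * K \<or> CARD('n) = 2 * K \<and> 3 \<le> K"
  shows "ext_degree \<phi> \<le> L_rk \<phi> TYPE('n) K"
  using assms(4)
proof
  assume K: "CARD('n) < 2 * K"
  define t where "t = CARD('n) - K"
  \<comment> \<open>The block lengths are 1, then \<open>t\<close> times 2, then again 1.\<close>
  define \<beta> where "\<beta> j = max ((j + 1) div 2) (j - t)" for j
  show ?thesis
  proof (rule full_weight_spectrum_code[of \<beta> K])
    show "\<beta> ` {..<CARD('n)} = {..<K}"
    proof (intro equalityI subsetI)
      fix i assume "i \<in> {..<K}"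
      \<comment> \<open>Block \<open>i\<close> ends at position \<open>2 * i\<close> while
        \<open>i \<le> t\<close>; a later one is the single position \<open>i + t\<close>.\<close>
      then have "i = \<beta> (if i \<le> t then 2 * i else i + t)" "(if i \<le> t then 2 * i else i + t) < CARD('n)"
        using K assms(3) by (auto simp: \<beta>_def t_def)
      then show "i \<in> \<beta> ` {..<CARD('n)}"
        by blast
    qed (use K assms(3) in \<open>auto simp: \<beta>_def t_def\<close>)
    show "j < i + 3" if "\<beta> i = \<beta> j" for i j
      using that by (auto simp: \<beta>_def max_def split: if_splits)
    show "\<exists>i I. i + w \<le> CARD('n) \<and> I \<subseteq> {..<K} \<and> (\<forall>j<CARD('n). \<beta> j \<in> I \<longleftrightarrow> i \<le> j \<and> j < i + w)"
      if w: "1 \<le> w" "w \<le> ext_degree \<phi>" for w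
    \<comment> \<open>A small even \<open>w\<close> is reached by skipping the initial block of
      length 1 and taking blocks of length 2; every other \<open>w\<close> by an initial
      interval.\<close>
    proof (cases "even w \<and> w \<le> 2 * t")
      case True
      then obtain r where r: "w = 2 * r"
        by blast
      have "1 + w \<le> CARD('n) \<and> {1..r} \<subseteq> {..<K} \<and>
        (\<forall>j<CARD('n). \<beta> j \<in> {1..r} \<longleftrightarrow> 1 \<le> j \<and> j < 1 + w)"
        using True r w assms K by (auto simp: \<beta>_def t_def max_def)
      then show ?thesis
        by blast
    next
      case False
      have "0 + w \<le> CARD('n) \<and> {..\<beta> (w - 1)} \<subseteq> {..<K} \<and>
        (\<forall>j<CARD('n). \<beta> j \<in> {..\<beta> (w - 1)} \<longleftrightarrow> 0 \<le> j \<and> j < 0 + w)"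
      proof (intro conjI allI impI)
        show "0 + w \<le> CARD('n)"
          using w assms by simp
        show "{..\<beta> (w - 1)} \<subseteq> {..<K}"
          using w assms K by (auto simp: \<beta>_def t_def)
        have mono: "\<beta> i \<le> \<beta> j" if "i \<le> j" for i j
          using that unfolding \<beta>_def by (intro max.mono div_le_mono diff_le_mono) auto
        \<comment> \<open>Blocks end at the even positions up to \<open>2 * t\<close> and at all
          later positions, hence at \<open>w - 1\<close>.\<close>
        have "\<beta> (w - 1) < \<beta> w"
          using False w by (cases "even w") (auto elim!: evenE oddE simp: \<beta>_def)
        then show "\<beta> j \<in> {..\<beta> (w - 1)} \<longleftrightarrow> 0 \<le> j \<and> j < 0 + w" for j
          using mono[of j "w - 1"] mono[of w j] w by (cases "j < w") auto
      qed
      then show ?thesis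
        by blast
    qed
  qed (use assms L_rk_ge in auto)
next
  assume K: "CARD('n) = 2 * K \<and> 3 \<le> K"
  \<comment> \<open>The block lengths are 1, 3, 2, 2, and so on.\<close>
  define \<beta> where "\<beta> j = (if j = 0 then 0 else if j \<le> 3 then 1 else j div 2)" for j :: nat
  show ?thesis
  proof (rule full_weight_spectrum_code[of \<beta> K])
    show "\<beta> ` {..<CARD('n)} = {..<K}"
    proof (intro equalityI subsetI)
      fix i assume "i \<in> {..<K}"
      then have "i = \<beta> (2 * i)" "2 * i < CARD('n)"
        using K by (auto simp: \<beta>_def)
      then show "i \<in> \<beta> ` {..<CARD('n)}"
        by blast
    qed (use K in \<open>auto simp: \<beta>_def\<close>)
    show "j < i + 3" if "\<beta> i = \<beta> j" for i j
      using that by (auto simp: \<beta>_def split: if_splits)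
    show "\<exists>i I. i + w \<le> CARD('n) \<and> I \<subseteq> {..<K} \<and> (\<forall>j<CARD('n). \<beta> j \<in> I \<longleftrightarrow> i \<le> j \<and> j < i + w)"
      if w: "1 \<le> w" "w \<le> ext_degree \<phi>" for w
    proof -
      have ex: ?thesis if "i + w \<le> 2 * K" "I \<subseteq> {..<K}"
          "\<And>j. \<beta> j \<in> I \<longleftrightarrow> i \<le> j \<and> j < i + w" for i I
        using that K by auto
      have "w < 2 * K"
        using w assms K by simp
      \<comment> \<open>Even \<open>w\<close> from 4 on use the blocks 1, 3, 2, ... from the start;
        odd \<open>w\<close> from 3 on omit the first block. Weight 2 is block number 2 alone, at
        positions 4 and 5.\<close>
      consider "w = 1" | "w = 2" | "even w" "4 \<le> w" | "odd w" "3 \<le> w"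
        using w by (cases "w = 1"; cases "w = 2"; cases "w = 3"; force)
      then show ?thesis
      proof cases
        case 1
        then show ?thesis
          using K by (intro ex[of 0 "{0}"]) (auto simp: \<beta>_def)
      next
        case 2
        then show ?thesis
          using K by (intro ex[of 4 "{2}"]) (auto simp: \<beta>_def)
      next
        case 3
        then show ?thesis
          using K \<open>w < 2 * K\<close> by (intro ex[of 0 "{..<w div 2}"]) (auto simp: \<beta>_def)
      next
        case 4
        then show ?thesis
          using K \<open>w < 2 * K\<close> by (intro ex[of 1 "{1..w div 2}"]) (auto simp: \<beta>_def elim!: oddE split: if_splits)
      qed
    qed
  qed (use assms L_rk_ge in auto)
qed

end

section \<open>Dimension of the dual code\<close>

text \<open>One vector \<open>y\<close> of \<open>S\<close> off the hyperplane, together with the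
  part of \<open>S\<close> in it, spans \<open>S\<close>: subtracting a suitable multiple of
  \<open>y\<close> moves any \<open>x\<close> into the hyperplane.\<close>

lemma vec_dim_le_dim_orthogonal_hyperplane:
  fixes S :: "('a::field ^ 'n) set"
  assumes "vec.subspace S"
  shows "vec.dim S \<le> Suc (vec.dim {x \<in> S. (\<Sum>i\<in>UNIV. c $ i * x $ i) = 0})"
proof -
  define f where "f x = (\<Sum>i\<in>UNIV. c $ i * x $ i)" for x :: "'a ^ 'n"
  have f_diff: "f (x - a *s y) = f x - a * f y" for x y a
    by (simp add: f_def algebra_simps sum_subtractf sum_distrib_left)
  define H where "H = {x \<in> S. f x = 0}"
  have "\<exists>y. S \<subseteq> vec.span (insert y H)"
  proof (cases "\<exists>y\<in>S. f y \<noteq> 0")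
    case True
    then obtain y where y: "y \<in> S" "f y \<noteq> 0"
      by blast
    have "x \<in> vec.span (insert y H)" if "x \<in> S" for x
    proof -
      have "x - (f x / f y) *s y \<in> H"
        using that y assms f_diff by (auto simp: H_def intro!: vec.subspace_diff vec.subspace_scale)
      then show ?thesis
        by (auto simp: vec.span_insert intro: vec.span_base)
    qed
    then show ?thesis
      by blast
  next
    case False
    then have "S \<subseteq> H"
      by (auto simp: H_def)
    then show ?thesis
      by (meson vec.span_superset order_trans subset_insertI)
  qed
  then obtain y where "S \<subseteq> vec.span (insert y H)"
    by blast
  then have "vec.dim S \<le> vec.dim (insert y H)"
    by (rule vec.dim_mono)
  also have "\<dots> \<le> Suc (vec.dim H)"
    by (simp add: vec.dim_insert)
  finally show ?thesis
    by (simp add: H_def f_def)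
qed

text \<open>Each vector of a basis of \<open>C\<close> imposes one linear equation. The bound makes
  one of the two dimensions at least half the length.\<close>

lemma dim_dual_code_ge:
  fixes C :: "('a::field ^ 'n) set"
  shows "CARD('n) \<le> vec.dim C + vec.dim (dual_code C)"
proof -
  obtain B where B: "vec.independent B" "C \<subseteq> vec.span B" "card B = vec.dim C"
    using vec.basis_exists[of C] by blast
  have subspace: "vec.subspace (dual_code A)" for A :: "('a ^ 'n) set"
    by (auto simp: dual_code_def vec.subspace_def algebra_simps sum.distrib
        simp flip: sum_distrib_left)
  have "CARD('n) \<le> card A + vec.dim (dual_code A)" if "finite A" for A :: "('a ^ 'n) set"
    using that
  proof induction
    case empty
    then show ?case
      by (simp add: dual_code_def vec_dim_card del: vec.dim_UNIV)
  next
    case (insert c A)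
    have "dual_code (insert c A) = {x \<in> dual_code A. (\<Sum>i\<in>UNIV. c $ i * x $ i) = 0}"
      by (auto simp: dual_code_def)
    then show ?case
      using insert vec_dim_le_dim_orthogonal_hyperplane[OF subspace, of A c] by simp
  qed
  then have "CARD('n) \<le> vec.dim C + vec.dim (dual_code B)"
    using B vec.finiteI_independent by metis
  moreover have "dual_code B \<subseteq> dual_code C"
  proof
    fix x assume x: "x \<in> dual_code B"
    \<comment> \<open>For fixed \<open>x\<close> the vectors orthogonal to \<open>x\<close> form a
      subspace, so orthogonality passes from \<open>B\<close> to its span.\<close>
    have "vec.span B \<subseteq> {c. (\<Sum>i\<in>UNIV. c $ i * x $ i) = 0}"
      using x by (intro vec.span_minimal) (auto simp: dual_code_def vec.subspace_def algebra_simps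
          sum.distrib simp flip: sum_distrib_left)
    then show "x \<in> dual_code C"
      using B(2) by (auto simp: dual_code_def)
  qed
  ultimately show ?thesis
    using vec.dim_subset[of "dual_code B" "dual_code C"] by linarith
qed

section \<open>Comparison of the code and its dual\<close>

theorem theoremA6:
  fixes \<phi> :: "'f::{field,finite} \<Rightarrow> 'a::{field,finite}"
    and C :: "('a ^ 'n) set"
    and q n m k d :: nat
  assumes "primepow q"
    and "field_embedding \<phi>"
    and "CARD('f) = q"
    and "ext_degree \<phi> = m"
    and "CARD('n) = n"
    and "1 < k" and "k < n"
    and "m < n" and "n \<le> k * m"
    and "m \<ge> 4 \<or> (m = 3 \<and> n \<ge> 5)"
    and "is_code k C"
    and "min_distance \<phi> C = d"
    and "nondegenerate \<phi> C"
    and "L_rk_optimal \<phi> C"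
  shows "\<not> nondegenerate \<phi> (dual_code C) \<or> \<not> L_rk_optimal \<phi> (dual_code C)"
proof (rule ccontr)
  assume "\<not> ?thesis"
  then have dual: "nondegenerate \<phi> (dual_code C)" "L_rk_optimal \<phi> (dual_code C)"
    by auto
  interpret field_extension \<phi>
    by unfold_locales fact
  have m: "3 \<le> ext_degree \<phi>" "ext_degree \<phi> < CARD('n)" "5 \<le> CARD('n)"
    using assms by auto
  have dim_C: "vec.dim C = k"
    using assms by (simp add: is_code_def)
  \<comment> \<open>Optimality turns the bound on the spectrum of this one code into a bound on the
    maximum.\<close>
  have "L_rk \<phi> TYPE('n) k < ext_degree \<phi>"
  proof -
    have "card (weight_spectrum \<phi> C) < ext_degree \<phi>"
      using m by (intro card_weight_spectrum_less rank_weight_ge_2[OF dual(1)])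
        (auto simp: dual_code_def)
    then show ?thesis
      using assms(14) by (simp add: L_rk_optimal_def dim_C)
  qed
  moreover have "L_rk \<phi> TYPE('n) (vec.dim (dual_code C)) < ext_degree \<phi>"
  proof -
    have "card (weight_spectrum \<phi> (dual_code C)) < ext_degree \<phi>"
      using m by (intro card_weight_spectrum_less rank_weight_ge_2[OF assms(13)])
        (auto simp: dual_code_def mult.commute)
    then show ?thesis
      using dual(2) by (simp add: L_rk_optimal_def)
  qed
  moreover have "vec.dim (dual_code C) \<le> CARD('n)"
    using vec.dim_subset[of "dual_code C" UNIV] by (simp add: vec_dim_card del: vec.dim_UNIV)
  \<comment> \<open>If \<open>CARD('n) \<le> 2 * k\<close>, the code dimension contradicts the block
    construction; equality gives \<open>3 \<le> k\<close>. Otherwise the dual has dimension above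
    half the length.\<close>
  ultimately show False
    using m assms(5,7) dim_dual_code_ge[of C] L_rk_ge_ext_degree[where 'n = 'n, of k]
      L_rk_ge_ext_degree[where 'n = 'n, of "vec.dim (dual_code C)"]
    by (cases "CARD('n) \<le> 2 * k") (simp_all add: dim_C, linarith)
qed

end
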